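(* For $j=1,\dots,6$ let $\mathcal T_j\subset\mathfrak k_A$ be the set of $Z\in\mathfrak k_A$ satisfying the $j$-th of the following conditions: (1) $u=0$; (2) $a=0$ and $d^2+v=u$; (3) $d=-a$ and $v=u$; (4) $a=d=0$ and $I=0$; (5) $d=3a$ and $up=3q^3$; (6) $\delta=0$, $I=0$ and $\Theta=0$. Then for each $j$, $\mathcal T_j\not\subseteq\bigcup_{k\neq j}\mathcal T_k$.
   Context: Octonions: $\mathbb O$ has real basis $1,e_1,\dots,e_7$ with $1$ the identity, $e_i^2=-1$, and multiplication given by the oriented triples $(123),(145),(176),(246),(257),(347),(365)$: for a triple $(abc)$, $e_ae_b=e_c$, $e_be_c=e_a$, $e_ce_a=e_b$, and reversing the order changes the sign. $\mathfrak g_2=\operatorname{Der}(\mathbb O)$. $D_{ij}=D_{e_i,e_j}\in\mathfrak g_2$ with $D_{a,b}(x)=[[a,b],x]-3[a,b,x]$, $[a,b]=ab-ba$, $[a,b,x]=(ab)x-a(bx)$. $H_A=\operatorname{span}\{1,e_1,e_2,e_3\}$ and $\mathfrak k_A=\{Z\in\mathfrak g_2:Z(H_A)\subseteq H_A\}$, with basis $D_{12},D_{13},D_{23},D_{45},D_{46},D_{47}$. Coordinates: write $Z=x_0D_{12}+x_1D_{13}+x_2D_{23}+x_3D_{45}+x_4D_{46}+x_5D_{47}$ and put $(a_1,a_2,a_3)=(2x_2-x_3,-2x_1-x_4,2x_0-x_5)$, $(b_1,b_2,b_3)=3(x_3,x_4,x_5)$, $a=a_1$, $d=b_1$, $q=a_2+ia_3\in\mathbb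 C$, $p=b_2+ib_3\in\mathbb C$. With $q^\ast$ the complex conjugate of $q$, define the real quantities $u=|q|^2$, $v=|p|^2$, $R+iI=p(q^\ast)^3$ ($R,I$ real), $\delta=a^2+u-d^2-v$, $\Theta=u\bigl((2v+3u)a-3ud\bigr)-(a+d)R$. *)

theory Defs
  imports "HOL-Analysis.Analysis"
begin

text \<open>
  Octonions are vectors in \<open>real ^ 8\<close>.  The index type \<open>8\<close> is the integers modulo 8; index \<open>0\<close>
  belongs to the unit \<open>1\<close>, and the indices \<open>1, ..., 7\<close> to \<open>e\<^sub>1, ..., e\<^sub>7\<close>.
\<close>

type_synonym oct = "real ^ 8"

definition oct_e :: "8 \<Rightarrow> oct" where
  "oct_e i = axis i 1"

definition oct_triples :: "(8 \<times> 8 \<times> 8) set" where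
  "oct_triples = {(1,2,3), (1,4,5), (1,7,6), (2,4,6), (2,5,7), (3,4,7), (3,6,5)}"

definition oct_pos :: "8 \<Rightarrow> 8 \<Rightarrow> 8 \<Rightarrow> bool" where
  "oct_pos i j k \<longleftrightarrow>
     (i, j, k) \<in> oct_triples \<or> (j, k, i) \<in> oct_triples \<or> (k, i, j) \<in> oct_triples"

text \<open>
  For distinct \<open>i, j \<noteq> 0\<close> there is exactly one \<open>k\<close> such that either \<open>oct_pos i j k\<close> or
  \<open>oct_pos j i k\<close>.  So in the last case below one sum is empty, and the other is \<open>oct_e k\<close>.
\<close>

definition oct_basis_mult :: "8 \<Rightarrow> 8 \<Rightarrow> oct" where
  "oct_basis_mult i j =
     (if i = 0 then oct_e j
      else if j = 0 then oct_e i
      else if i = j then - oct_e 0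
      else (\<Sum>k | oct_pos i j k. oct_e k) - (\<Sum>k | oct_pos j i k. oct_e k))"

definition oct_mult :: "oct \<Rightarrow> oct \<Rightarrow> oct" (infixl \<open>\<odot>\<close> 70) where
  "x \<odot> y = (\<Sum>i\<in>UNIV. \<Sum>j\<in>UNIV. (x $ i * y $ j) *\<^sub>R oct_basis_mult i j)"

definition oct_commutator :: "oct \<Rightarrow> oct \<Rightarrow> oct" where
  "oct_commutator a b = a \<odot> b - b \<odot> a"

definition oct_associator :: "oct \<Rightarrow> oct \<Rightarrow> oct \<Rightarrow> oct" where
  "oct_associator a b x = (a \<odot> b) \<odot> x - a \<odot> (b \<odot> x)"

definition g2 :: "(oct \<Rightarrow> oct) set" where
  "g2 = {Z. linear Z \<and> (\<forall>x y. Z (x \<odot> y) = Z x \<odot> y + x \<odot> Z y)}"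

definition oct_deriv :: "oct \<Rightarrow> oct \<Rightarrow> oct \<Rightarrow> oct" where
  "oct_deriv a b x = oct_commutator (oct_commutator a b) x - 3 *\<^sub>R oct_associator a b x"

definition D :: "8 \<Rightarrow> 8 \<Rightarrow> oct \<Rightarrow> oct" where
  "D i j = oct_deriv (oct_e i) (oct_e j)"

definition H_A :: "oct set" where
  "H_A = span {oct_e 0, oct_e 1, oct_e 2, oct_e 3}"

definition k_A :: "(oct \<Rightarrow> oct) set" where
  "k_A = {Z \<in> g2. Z ` H_A \<subseteq> H_A}"

definition k_A_elem :: "real \<Rightarrow> real \<Rightarrow> real \<Rightarrow> real \<Rightarrow> real \<Rightarrow> real \<Rightarrow> oct \<Rightarrow> oct" where
  "k_A_elem x0 x1 x2 x3 x4 x5 = (\<lambda>w.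
     x0 *\<^sub>R D 1 2 w + x1 *\<^sub>R D 1 3 w + x2 *\<^sub>R D 2 3 w +
     x3 *\<^sub>R D 4 5 w + x4 *\<^sub>R D 4 6 w + x5 *\<^sub>R D 4 7 w)"

definition T_cond :: "nat \<Rightarrow> real \<Rightarrow> real \<Rightarrow> complex \<Rightarrow> complex \<Rightarrow> bool" where
  "T_cond j a d q p =
     (let u = (cmod q)\<^sup>2;
          v = (cmod p)\<^sup>2;
          R = Re (p * cnj q ^ 3);
          I = Im (p * cnj q ^ 3);
          \<delta> = a\<^sup>2 + u - d\<^sup>2 - v;
          \<Theta> = u * ((2 * v + 3 * u) * a - 3 * u * d) - (a + d) * R
      in if j = 1 then u = 0
         else if j = 2 then a = 0 \<and> d\<^sup>2 + v = u
         else if j = 3 then d = - a \<and> v = u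
         else if j = 4 then a = 0 \<and> d = 0 \<and> I = 0
         else if j = 5 then d = 3 * a \<and> of_real u * p = 3 * q ^ 3
         else if j = 6 then \<delta> = 0 \<and> I = 0 \<and> \<Theta> = 0
         else False)"

text \<open>
  The six derivations in \<open>k_A_elem\<close> form a basis of \<open>k_A\<close>, so the existential quantifier below
  ranges over exactly one tuple of coordinates for each \<open>Z\<close>.  The arguments of \<open>T_cond\<close> are
  \<open>a = a\<^sub>1\<close>, \<open>d = b\<^sub>1\<close>, \<open>q = a\<^sub>2 + i a\<^sub>3\<close> and \<open>p = b\<^sub>2 + i b\<^sub>3\<close>.
\<close>

definition T :: "nat \<Rightarrow> (oct \<Rightarrow> oct) set" where
  "T j = {Z \<in> k_A. \<exists>x0 x1 x2 x3 x4 x5. Z = k_A_elem x0 x1 x2 x3 x4 x5 \<and>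
     T_cond j (2 * x2 - x3) (3 * x3)
       (Complex (- 2 * x1 - x4) (2 * x0 - x5)) (Complex (3 * x4) (3 * x5))}"

end

theory Submission
  imports Defs
begin

text \<open>
  The six derivations spanning \<open>k_A\<close> act linearly on the coordinates of an octonion, and their
  matrix entries determine the coefficients of a linear combination.  The map from the
  coefficients to \<open>(a, d, q, p)\<close> is onto, so it suffices to find, for each \<open>j\<close>, one point
  \<open>(a, d, q, p)\<close> at which the \<open>j\<close>-th condition holds and the other five fail.
\<close>

lemma UNIV_8: "(UNIV :: 8 set) = {0, 1, 2, 3, 4, 5, 6, 7}"
  by (rule sym, rule card_subset_eq) simp_all

lemma sum_8: "sum f (UNIV :: 8 set) = f 0 + f 1 + f 2 + f 3 + f 4 + f 5 + f 6 + f 7"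
  for f :: "8 \<Rightarrow> 'a::comm_monoid_add"
  unfolding UNIV_8 by (simp, simp only: add.assoc)

lemma forall_8: "(\<forall>i::8. P i) \<longleftrightarrow> P 0 \<and> P 1 \<and> P 2 \<and> P 3 \<and> P 4 \<and> P 5 \<and> P 6 \<and> P 7"
proof -
  have "(\<forall>i. P i) \<longleftrightarrow> (\<forall>i \<in> UNIV. P i)" by simp
  then show ?thesis unfolding UNIV_8 by simp
qed

lemma oct_eq_iff:
  "x = y \<longleftrightarrow> x $ 0 = y $ 0 \<and> x $ 1 = y $ 1 \<and> x $ 2 = y $ 2 \<and> x $ 3 = y $ 3 \<and>
    x $ 4 = y $ 4 \<and> x $ 5 = y $ 5 \<and> x $ 6 = y $ 6 \<and> x $ 7 = y $ 7" for x y :: oct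
  by (simp add: vec_eq_iff forall_8)

lemma oct_e_nth: "oct_e i $ k = (if k = i then 1 else 0)"
  by (simp add: oct_e_def axis_def)

text \<open>At most the summand with index \<open>m\<close> contributes, so the sums over index sets
  in \<open>oct_basis_mult\<close> become tests of \<open>oct_pos\<close>.\<close>

lemma sum_oct_e_nth: "(\<Sum>k | P k. oct_e k) $ m = (if P m then 1 else 0)"
  by (simp add: oct_e_nth sum.delta')

text \<open>
  The simplifier re-normalises numerals of type \<open>8\<close> each time it compares two of them, which is
  too slow for the multiplication table; there the inequalities below are used instead.
\<close>

lemma distinct_8: "distinct [0, 1, 2, 3, 4, 5, 6, 7 :: 8]" "distinct [7, 6, 5, 4, 3, 2, 1, 0 :: 8]"
  by simp_all

lemmas neq_8 = distinct_8[unfolded distinct.simps list.set insert_iff empty_iff de_Morgan_disj simp_thms]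

lemma oct_basis_mult_nth:
  "oct_basis_mult i j $ k =
    (if i = 0 then (if k = j then 1 else 0)
     else if j = 0 then (if k = i then 1 else 0)
     else if i = j then (if k = 0 then - 1 else 0)
     else (if oct_pos i j k then 1 else 0) - (if oct_pos j i k then 1 else 0))"
  by (simp add: oct_basis_mult_def sum_oct_e_nth oct_e_nth)

lemma oct_mult_nth_eq_sum:
  "(x \<odot> y) $ k = (\<Sum>i\<in>UNIV. \<Sum>j\<in>UNIV. x $ i * y $ j * oct_basis_mult i j $ k)"
  by (simp add: oct_mult_def)

lemma oct_mult_nth:
  shows
    "(x \<odot> y) $ 0 = x $ 0 * y $ 0 - x $ 1 * y $ 1 - x $ 2 * y $ 2 - x $ 3 * y $ 3 -
      x $ 4 * y $ 4 - x $ 5 * y $ 5 - x $ 6 * y $ 6 - x $ 7 * y $ 7"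
    "(x \<odot> y) $ 1 = x $ 0 * y $ 1 + x $ 1 * y $ 0 + x $ 2 * y $ 3 - x $ 3 * y $ 2 +
      x $ 4 * y $ 5 - x $ 5 * y $ 4 - x $ 6 * y $ 7 + x $ 7 * y $ 6"
    "(x \<odot> y) $ 2 = x $ 0 * y $ 2 - x $ 1 * y $ 3 + x $ 2 * y $ 0 + x $ 3 * y $ 1 +
      x $ 4 * y $ 6 + x $ 5 * y $ 7 - x $ 6 * y $ 4 - x $ 7 * y $ 5"
    "(x \<odot> y) $ 3 = x $ 0 * y $ 3 + x $ 1 * y $ 2 - x $ 2 * y $ 1 + x $ 3 * y $ 0 +
      x $ 4 * y $ 7 - x $ 5 * y $ 6 + x $ 6 * y $ 5 - x $ 7 * y $ 4"
    "(x \<odot> y) $ 4 = x $ 0 * y $ 4 - x $ 1 * y $ 5 - x $ 2 * y $ 6 - x $ 3 * y $ 7 +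
      x $ 4 * y $ 0 + x $ 5 * y $ 1 + x $ 6 * y $ 2 + x $ 7 * y $ 3"
    "(x \<odot> y) $ 5 = x $ 0 * y $ 5 + x $ 1 * y $ 4 - x $ 2 * y $ 7 + x $ 3 * y $ 6 -
      x $ 4 * y $ 1 + x $ 5 * y $ 0 - x $ 6 * y $ 3 + x $ 7 * y $ 2"
    "(x \<odot> y) $ 6 = x $ 0 * y $ 6 + x $ 1 * y $ 7 + x $ 2 * y $ 4 - x $ 3 * y $ 5 -
      x $ 4 * y $ 2 + x $ 5 * y $ 3 + x $ 6 * y $ 0 - x $ 7 * y $ 1"
    "(x \<odot> y) $ 7 = x $ 0 * y $ 7 - x $ 1 * y $ 6 + x $ 2 * y $ 5 + x $ 3 * y $ 4 -
      x $ 4 * y $ 3 - x $ 5 * y $ 2 + x $ 6 * y $ 1 + x $ 7 * y $ 0"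
  unfolding oct_mult_nth_eq_sum sum_8
  by (simp_all only: oct_basis_mult_nth oct_pos_def oct_triples_def neq_8 insert_iff empty_iff
      prod.inject simp_thms if_True if_False, simp_all)

lemma oct_e_mult:
  shows
    "oct_e 1 \<odot> oct_e 2 = oct_e 3"
    "oct_e 2 \<odot> oct_e 1 = - oct_e 3"
    "oct_e 1 \<odot> oct_e 3 = - oct_e 2"
    "oct_e 3 \<odot> oct_e 1 = oct_e 2"
    "oct_e 2 \<odot> oct_e 3 = oct_e 1"
    "oct_e 3 \<odot> oct_e 2 = - oct_e 1"
    "oct_e 4 \<odot> oct_e 5 = oct_e 1"
    "oct_e 5 \<odot> oct_e 4 = - oct_e 1"
    "oct_e 4 \<odot> oct_e 6 = oct_e 2"
    "oct_e 6 \<odot> oct_e 4 = - oct_e 2"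
    "oct_e 4 \<odot> oct_e 7 = oct_e 3"
    "oct_e 7 \<odot> oct_e 4 = - oct_e 3"
  by (simp_all add: oct_eq_iff oct_mult_nth oct_e_nth)

text \<open>The matrix is skew-symmetric, with a zero row for the unit and blocks on the indices 1
  to 3 and 4 to 7. Hence \<open>H_A\<close> is preserved.\<close>

lemma k_A_elem_nth:
  shows
    "k_A_elem x0 x1 x2 x3 x4 x5 w $ 0 = 0"
    "k_A_elem x0 x1 x2 x3 x4 x5 w $ 1 = (- 4 * x0 + 2 * x5) * w $ 2 + (- 4 * x1 - 2 * x4) * w $ 3"
    "k_A_elem x0 x1 x2 x3 x4 x5 w $ 2 = (4 * x0 - 2 * x5) * w $ 1 + (- 4 * x2 + 2 * x3) * w $ 3"
    "k_A_elem x0 x1 x2 x3 x4 x5 w $ 3 = (4 * x1 + 2 * x4) * w $ 1 + (4 * x2 - 2 * x3) * w $ 2"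
    "k_A_elem x0 x1 x2 x3 x4 x5 w $ 4 = (2 * x2 - 4 * x3) * w $ 5 +
      (- 2 * x1 - 4 * x4) * w $ 6 + (2 * x0 - 4 * x5) * w $ 7"
    "k_A_elem x0 x1 x2 x3 x4 x5 w $ 5 = (- 2 * x2 + 4 * x3) * w $ 4 +
      (- 2 * x0 - 2 * x5) * w $ 6 + (- 2 * x1 + 2 * x4) * w $ 7"
    "k_A_elem x0 x1 x2 x3 x4 x5 w $ 6 = (2 * x1 + 4 * x4) * w $ 4 +
      (2 * x0 + 2 * x5) * w $ 5 + (- 2 * x2 - 2 * x3) * w $ 7"
    "k_A_elem x0 x1 x2 x3 x4 x5 w $ 7 = (- 2 * x0 + 4 * x5) * w $ 4 +
      (2 * x1 - 2 * x4) * w $ 5 + (2 * x2 + 2 * x3) * w $ 6"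
  by (simp_all add: k_A_elem_def D_def oct_deriv_def oct_commutator_def oct_associator_def oct_e_mult
      oct_mult_nth oct_e_nth, simp_all add: algebra_simps)

lemma linear_k_A_elem: "linear (k_A_elem x0 x1 x2 x3 x4 x5)"
  by (rule linearI) (simp_all add: oct_eq_iff k_A_elem_nth algebra_simps)

lemma k_A_elem_mult:
  "k_A_elem x0 x1 x2 x3 x4 x5 (x \<odot> y) =
    k_A_elem x0 x1 x2 x3 x4 x5 x \<odot> y + x \<odot> k_A_elem x0 x1 x2 x3 x4 x5 y"
  \<comment> \<open>In coordinates the Leibniz rule is eight polynomial identities.\<close>
  unfolding oct_eq_iff vector_add_component oct_mult_nth k_A_elem_nth by (intro conjI; algebra)

lemma H_A_eq: "H_A = {w. w $ 4 = 0 \<and> w $ 5 = 0 \<and> w $ 6 = 0 \<and> w $ 7 = 0}" (is "_ = ?W")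
proof
  have "subspace ?W" by (simp add: subspace_def)
  then show "H_A \<subseteq> ?W"
    unfolding H_A_def by (intro span_minimal) (auto simp: oct_e_nth)
  show "?W \<subseteq> H_A"
  proof
    fix w :: oct assume "w \<in> ?W"
    then have "w = w $ 0 *\<^sub>R oct_e 0 + w $ 1 *\<^sub>R oct_e 1 + w $ 2 *\<^sub>R oct_e 2 + w $ 3 *\<^sub>R oct_e 3"
      by (simp add: oct_eq_iff oct_e_nth)
    moreover have "\<dots> \<in> H_A"
      unfolding H_A_def by (intro span_add span_scale span_base) auto
    ultimately show "w \<in> H_A" by simp
  qed
qed

lemma k_A_elem_in_k_A: "k_A_elem x0 x1 x2 x3 x4 x5 \<in> k_A"
  by (auto simp: k_A_def g2_def linear_k_A_elem k_A_elem_mult H_A_eq k_A_elem_nth)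

lemma k_A_elem_inject:
  "k_A_elem x0 x1 x2 x3 x4 x5 = k_A_elem y0 y1 y2 y3 y4 y5 \<longleftrightarrow>
    x0 = y0 \<and> x1 = y1 \<and> x2 = y2 \<and> x3 = y3 \<and> x4 = y4 \<and> x5 = y5"
proof
  assume eq: "k_A_elem x0 x1 x2 x3 x4 x5 = k_A_elem y0 y1 y2 y3 y4 y5"
  have entry: "k_A_elem x0 x1 x2 x3 x4 x5 (oct_e i) $ k = k_A_elem y0 y1 y2 y3 y4 y5 (oct_e i) $ k" for i k
    by (simp add: eq)
  show "x0 = y0 \<and> x1 = y1 \<and> x2 = y2 \<and> x3 = y3 \<and> x4 = y4 \<and> x5 = y5"
    \<comment> \<open>These six entries form three invertible 2 by 2 systems, in
      \<open>(x0, x5)\<close>, \<open>(x1, x4)\<close> and \<open>(x2, x3)\<close>.\<close>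
    using entry[of 1 2] entry[of 1 3] entry[of 2 3] entry[of 4 5] entry[of 4 6] entry[of 4 7]
    by (simp add: k_A_elem_nth oct_e_nth)
qed simp

text \<open>Uniqueness of the coefficients removes the existential quantifier in
  \<open>T\<close>.\<close>

lemma k_A_elem_in_T_iff:
  "k_A_elem x0 x1 x2 x3 x4 x5 \<in> T j \<longleftrightarrow>
    T_cond j (2 * x2 - x3) (3 * x3)
      (Complex (- 2 * x1 - x4) (2 * x0 - x5)) (Complex (3 * x4) (3 * x5))"
  unfolding T_def by (auto simp: k_A_elem_in_k_A k_A_elem_inject)

lemma ex_T_iff: "\<exists>Z. \<forall>j. Z \<in> T j \<longleftrightarrow> T_cond j a d q p"
proof (intro exI allI)
  \<comment> \<open>Inverts the coordinate change: \<open>d\<close> and \<open>p\<close> give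
    \<open>x3\<close>, \<open>x4\<close>, \<open>x5\<close>, and then \<open>a\<close> and
    \<open>q\<close> give the rest.\<close>
  let ?Z = "k_A_elem ((Im q + Im p / 3) / 2) (- (Re q + Re p / 3) / 2) ((a + d / 3) / 2)
    (d / 3) (Re p / 3) (Im p / 3)"
  show "?Z \<in> T j \<longleftrightarrow> T_cond j a d q p" for j
    by (simp add: k_A_elem_in_T_iff field_simps)
qed

lemma T_cond_independent:
  assumes "j \<in> {1..6}"
  shows "\<exists>a d q p. \<forall>k \<in> {1..6}. T_cond k a d q p \<longleftrightarrow> k = j"
proof -
  have range: "(\<forall>k \<in> {1..6::nat}. P k) \<longleftrightarrow> P 1 \<and> P 2 \<and> P 3 \<and> P 4 \<and> P 5 \<and> P 6" for P
    by (simp add: atLeastAtMost_upt upt_rec numeral_eq_Suc)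
  note eval = T_cond_def Let_def cmod_power2 complex_eq_iff power3_eq_cube
  consider "j = 1" | "j = 2" | "j = 3" | "j = 4" | "j = 5" | "j = 6"
    using assms by force
  then show ?thesis
  proof cases
    case 1
    show ?thesis
      unfolding range 1
      \<comment> \<open>At \<open>q = 0\<close> both \<open>I\<close> and \<Theta> vanish; \<delta>
        = 1 excludes condition 6.\<close>
      by (rule exI[of _ 1], rule exI[of _ 0], rule exI[of _ 0], rule exI[of _ 0])
        (simp add: eval)
  next
    case 2
    show ?thesis
      unfolding range 2
      \<comment> \<open>Condition 2 forces \<delta> = 0. The triple 3, 4, 5 solves it, and an
        imaginary \<open>p\<close> makes \<open>I\<close> nonzero, which excludes 4 and 6.\<close>
      by (rule exI[of _ 0], rule exI[of _ 3], rule exI[of _ 5], rule exI[of _ "Complex 0 4"])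
        (simp add: eval)
  next
    case 3
    show ?thesis
      unfolding range 3
      \<comment> \<open>Condition 3 forces \<delta> = 0 and \<Theta> = \<open>8 * a * u^2\<close>,
        so nonzero \<open>a\<close> and \<open>u\<close> exclude condition 6.\<close>
      by (rule exI[of _ 1], rule exI[of _ "- 1"], rule exI[of _ 1], rule exI[of _ \<i>])
        (simp add: eval)
  next
    case 4
    show ?thesis
      unfolding range 4
      \<comment> \<open>Here \<open>d = - a\<close> and \<open>d = 3 * a\<close> both hold. Since
        \<open>v\<close> differs from \<open>u\<close>, conditions 2, 3 and 6 fail; 5 fails as
        \<open>p = 0\<close> but \<open>q\<close> is nonzero.\<close>
      by (rule exI[of _ 0], rule exI[of _ 0], rule exI[of _ 1], rule exI[of _ 0])
        (simp add: eval)
  next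
    case 5
    show ?thesis
      unfolding range 5
      \<comment> \<open>For nonzero \<open>q\<close>, condition 5 gives \<open>v = 9 * u\<close>, so
        \<delta> = \<open>- 8 * (a^2 + u)\<close> is nonzero.\<close>
      by (rule exI[of _ 1], rule exI[of _ 3], rule exI[of _ 1], rule exI[of _ 3])
        (simp add: eval)
  next
    case 6
    show ?thesis
      unfolding range 6
      \<comment> \<open>With \<open>a = d\<close> and \<open>u = v\<close>, \<delta> vanishes; all
        values being 1, \<Theta> = (5 - 3) - 2 = 0.\<close>
      by (rule exI[of _ 1], rule exI[of _ 1], rule exI[of _ 1], rule exI[of _ 1])
        (simp add: eval)
  qed
qed

theorem proposition8p3:
  fixes j :: nat
  assumes "j \<in> {1..6}"
  shows "\<not> T j \<subseteq> (\<Union>k \<in> {1..6} - {j}. T k)"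
proof -
  obtain a d q p where cond: "\<And>k. k \<in> {1..6} \<Longrightarrow> T_cond k a d q p \<longleftrightarrow> k = j"
    using T_cond_independent[OF assms] by blast
  obtain Z where Z: "\<And>k. Z \<in> T k \<longleftrightarrow> T_cond k a d q p"
    using ex_T_iff by blast
  have "Z \<in> T j" using Z cond assms by simp
  moreover have "Z \<notin> (\<Union>k \<in> {1..6} - {j}. T k)" using Z cond by auto
  ultimately show ?thesis by blast
qed

end
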